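(* Let $\alpha,\beta,\gamma,\delta\in\mathbb{R}$ with $\alpha+\delta\neq 0$ and $\alpha\gamma+\beta\delta=0$. Let $G_5$ be the connected, simply connected three-dimensional Lie group with left-invariant Lorentzian metric $g$ whose Lie algebra has a pseudo-orthonormal basis $\{e_1,e_2,e_3\}$, $e_3$ timelike, with $$[e_1,e_2]=0,\quad [e_1,e_3]=\alpha e_1+\beta e_2,\quad [e_2,e_3]=\gamma e_1+\delta e_2.$$ Let $V=\lambda_1e_1+\lambda_2e_2+\lambda_3e_3$ with $\lambda_1,\lambda_2,\lambda_3\in\mathbb{R}$, and let $\lambda\in\mathbb{R}$. Then $(G_5,V,g)$ is a left-invariant Riemann soliton with constant $\lambda$ if and only if one of the following holds: (i) $\beta+\gamma=0$, $\beta\neq 0$, $\alpha=\delta$, $\alpha\neq 0$, $\lambda_1=\lambda_2=\lambda_3=0$, $\lambda=-\alpha^2$; (ii) $\beta=\gamma=0$, $\alpha=\delta$, $\alpha\neq 0$, $\lambda_1=\lambda_2=\lambda_3=0$, $\lambda=-\alpha^2$.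
   Context: Elements of the Lie algebra are identified with left-invariant vector fields. A pseudo-orthonormal basis $\{e_1,e_2,e_3\}$ with $e_3$ timelike means $g(e_1,e_1)=g(e_2,e_2)=1$, $g(e_3,e_3)=-1$, and $g(e_i,e_j)=0$ for $i\ne j$. Let $\nabla$ be the Levi-Civita connection of $g$, with curvature $R(X,Y)Z=\nabla_X\nabla_YZ-\nabla_Y\nabla_XZ-\nabla_{[X,Y]}Z$, and set $R(X,Y,Z,W)=-g(R(X,Y)Z,W)$. For $(0,2)$-tensors $T_1,T_2$ the Kulkarni-Nomizu product is $$(T_1\wedge T_2)(X,Y,Z,W)=T_1(X,W)T_2(Y,Z)+T_1(Y,Z)T_2(X,W)-T_1(X,Z)T_2(Y,W)-T_1(Y,W)T_2(X,Z).$$ $L_Vg$ denotes the Lie derivative of $g$ along $V$. For a left-invariant vector field $V$ and a real constant $\lambda$, $(G,V,g)$ is a left-invariant Riemann soliton with constant $\lambda$ if $R+\frac12 L_Vg\wedge g=\frac{\lambda}{2}g\wedge g$, i.e. for all vector fields $X,Y,Z,W$, $$2R(X,Y,Z,W)+g(X,W)(L_Vg)(Y,Z)+g(Y,Z)(L_Vg)(X,W)-g(X,Z)(L_Vg)(Y,W)-g(Y,W)(L_Vg)(X,Z)=2\lambda[g(X,W)g(Y,Z)-g(X,Z)g(Y,W)].$$ *)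

theory Defs
  imports "HOL-Analysis.Analysis"
begin

section \<open>Smooth maps between open subsets of Euclidean spaces\<close>

text \<open>Meant for open \<open>S\<close> only: derivatives are taken in full neighbourhoods.\<close>

primrec Ck_on :: "nat \<Rightarrow> ('a::euclidean_space \<Rightarrow> 'b::euclidean_space) \<Rightarrow> 'a set \<Rightarrow> bool" where
  "Ck_on 0 f S \<longleftrightarrow> continuous_on S f"
| "Ck_on (Suc k) f S \<longleftrightarrow>
     (\<forall>x\<in>S. f differentiable (at x)) \<and>
     (\<forall>v. Ck_on k (\<lambda>x. frechet_derivative f (at x) v) S)"

definition smooth_on :: "('a::euclidean_space \<Rightarrow> 'b::euclidean_space) \<Rightarrow> 'a set \<Rightarrow> bool" where
  "smooth_on f S \<longleftrightarrow> (\<forall>k. Ck_on k f S)"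


section \<open>Smooth manifolds and Lie groups\<close>

text \<open>
  A manifold occupies a whole type \<open>'a\<close>, is modelled on the Euclidean space \<open>'e\<close>, and is given
  by a (not necessarily maximal) smooth atlas. A chart is a pair of its domain and its coordinate
  map; values of the coordinate map outside the domain are irrelevant.
\<close>

type_synonym ('a, 'e) atlas = "('a set \<times> ('a \<Rightarrow> 'e)) set"

definition is_chart :: "'a::topological_space set \<Rightarrow> ('a \<Rightarrow> 'e::euclidean_space) \<Rightarrow> bool" where
  "is_chart U \<phi> \<longleftrightarrow>
     open U \<and> open (\<phi> ` U) \<and> homeomorphism U (\<phi> ` U) \<phi> (inv_into U \<phi>)"

definition smooth_atlas ::
    "('a::{t2_space, second_countable_topology}, 'e::euclidean_space) atlas \<Rightarrow> bool" where
  "smooth_atlas A \<longleftrightarrow>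
     (\<Union>(U, \<phi>)\<in>A. U) = UNIV \<and>
     (\<forall>(U, \<phi>)\<in>A. is_chart U \<phi>) \<and>
     (\<forall>(U, \<phi>)\<in>A. \<forall>(W, \<psi>)\<in>A. smooth_on (\<psi> \<circ> inv_into U \<phi>) (\<phi> ` (U \<inter> W)))"

definition smooth_fun_on ::
    "('a::topological_space, 'e::euclidean_space) atlas \<Rightarrow> 'a set \<Rightarrow> ('a \<Rightarrow> real) \<Rightarrow> bool" where
  "smooth_fun_on A W f \<longleftrightarrow> (\<forall>(U, \<phi>)\<in>A. smooth_on (f \<circ> inv_into U \<phi>) (\<phi> ` (U \<inter> W)))"

definition smooth_near ::
    "('a::topological_space, 'e::euclidean_space) atlas \<Rightarrow> 'a \<Rightarrow> ('a \<Rightarrow> real) \<Rightarrow> bool" where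
  "smooth_near A p f \<longleftrightarrow> (\<exists>W. open W \<and> p \<in> W \<and> smooth_fun_on A W f)"

definition smooth_fun ::
    "('a::topological_space, 'e::euclidean_space) atlas \<Rightarrow> ('a \<Rightarrow> real) \<Rightarrow> bool" where
  "smooth_fun A f \<longleftrightarrow> smooth_fun_on A UNIV f"

definition smooth_self_map ::
    "('a::topological_space, 'e::euclidean_space) atlas \<Rightarrow> ('a \<Rightarrow> 'a) \<Rightarrow> bool" where
  "smooth_self_map A h \<longleftrightarrow>
     continuous_on UNIV h \<and>
     (\<forall>(U, \<phi>)\<in>A. \<forall>(W, \<omega>)\<in>A.
        smooth_on (\<omega> \<circ> h \<circ> inv_into U \<phi>) (\<phi> ` {x \<in> U. h x \<in> W}))"

definition smooth_binary_map ::
    "('a::topological_space, 'e::euclidean_space) atlas \<Rightarrow> ('a \<Rightarrow> 'a \<Rightarrow> 'a) \<Rightarrow> bool" where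
  "smooth_binary_map A h \<longleftrightarrow>
     continuous_on UNIV (\<lambda>(x, y). h x y) \<and>
     (\<forall>(U, \<phi>)\<in>A. \<forall>(V, \<psi>)\<in>A. \<forall>(W, \<omega>)\<in>A.
        smooth_on (\<lambda>(u, v). \<omega> (h (inv_into U \<phi> u) (inv_into V \<psi> v)))
          ((\<lambda>(x, y). (\<phi> x, \<psi> y)) ` {(x, y). x \<in> U \<and> y \<in> V \<and> h x y \<in> W}))"

definition lie_group ::
    "('a::{t2_space, second_countable_topology}, 'e::euclidean_space) atlas
      \<Rightarrow> ('a \<Rightarrow> 'a \<Rightarrow> 'a) \<Rightarrow> 'a \<Rightarrow> ('a \<Rightarrow> 'a) \<Rightarrow> bool" where
  "lie_group A mul u iv \<longleftrightarrow>
     smooth_atlas A \<and> group mul u iv \<and> smooth_binary_map A mul \<and> smooth_self_map A iv"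


section \<open>Tangent vectors and vector fields\<close>

text \<open>
  A tangent vector at \<open>p\<close> is identified with the directional derivative it induces on the functions
  that are smooth near \<open>p\<close>. It is set to 0 on all other functions, so that tangent vectors are
  equal iff they agree on all functions smooth near \<open>p\<close>.
\<close>

type_synonym 'a tvec = "('a \<Rightarrow> real) \<Rightarrow> real"
type_synonym 'a vfield = "'a \<Rightarrow> 'a tvec"

definition tangent_space ::
    "('a::topological_space, 'e::euclidean_space) atlas \<Rightarrow> 'a \<Rightarrow> 'a tvec set" where
  "tangent_space A p =
     {(\<lambda>f. if smooth_near A p f
           then frechet_derivative (f \<circ> inv_into U \<phi>) (at (\<phi> p)) \<xi> else 0) | U \<phi> \<xi>.
       (U, \<phi>) \<in> A \<and> p \<in> U}"

definition vector_field ::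
    "('a::topological_space, 'e::euclidean_space) atlas \<Rightarrow> 'a vfield \<Rightarrow> bool" where
  "vector_field A X \<longleftrightarrow>
     (\<forall>p. X p \<in> tangent_space A p) \<and>
     (\<forall>W f. open W \<longrightarrow> smooth_fun_on A W f \<longrightarrow> smooth_fun_on A W (\<lambda>p. X p f))"

definition tv_add :: "'a tvec \<Rightarrow> 'a tvec \<Rightarrow> 'a tvec" where
  "tv_add u v = (\<lambda>f. u f + v f)"

definition tv_scale :: "real \<Rightarrow> 'a tvec \<Rightarrow> 'a tvec" where
  "tv_scale c u = (\<lambda>f. c * u f)"

definition vf_add :: "'a vfield \<Rightarrow> 'a vfield \<Rightarrow> 'a vfield" where
  "vf_add X Y = (\<lambda>p. tv_add (X p) (Y p))"

definition vf_diff :: "'a vfield \<Rightarrow> 'a vfield \<Rightarrow> 'a vfield" where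
  "vf_diff X Y = (\<lambda>p. tv_add (X p) (tv_scale (-1) (Y p)))"

definition vf_mult :: "('a \<Rightarrow> real) \<Rightarrow> 'a vfield \<Rightarrow> 'a vfield" where
  "vf_mult h X = (\<lambda>p. tv_scale (h p) (X p))"

definition vf_app :: "'a vfield \<Rightarrow> ('a \<Rightarrow> real) \<Rightarrow> 'a \<Rightarrow> real" where
  "vf_app X f = (\<lambda>p. X p f)"

definition lie_bracket ::
    "('a::topological_space, 'e::euclidean_space) atlas \<Rightarrow> 'a vfield \<Rightarrow> 'a vfield \<Rightarrow> 'a vfield" where
  "lie_bracket A X Y =
     (\<lambda>p f. if smooth_near A p f then X p (vf_app Y f) - Y p (vf_app X f) else 0)"

definition push_left :: "('a \<Rightarrow> 'a \<Rightarrow> 'a) \<Rightarrow> 'a \<Rightarrow> 'a tvec \<Rightarrow> 'a tvec" where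
  \<comment> \<open>the differential of the left translation by \<open>a\<close>\<close>
  "push_left mul a v = (\<lambda>f. v (\<lambda>x. f (mul a x)))"

definition lie_algebra ::
    "('a::topological_space, 'e::euclidean_space) atlas \<Rightarrow> ('a \<Rightarrow> 'a \<Rightarrow> 'a) \<Rightarrow> 'a vfield set" where
  "lie_algebra A mul =
     {X. vector_field A X \<and> (\<forall>a p. X (mul a p) = push_left mul a (X p))}"

definition lincomb3 ::
    "real \<Rightarrow> real \<Rightarrow> real \<Rightarrow> 'a vfield \<Rightarrow> 'a vfield \<Rightarrow> 'a vfield \<Rightarrow> 'a vfield" where
  "lincomb3 a b c X Y Z = (\<lambda>p f. a * X p f + b * Y p f + c * Z p f)"

definition lie_algebra_basis3 ::
    "('a::topological_space, 'e::euclidean_space) atlas \<Rightarrow> ('a \<Rightarrow> 'a \<Rightarrow> 'a)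
      \<Rightarrow> 'a vfield \<Rightarrow> 'a vfield \<Rightarrow> 'a vfield \<Rightarrow> bool" where
  "lie_algebra_basis3 A mul X Y Z \<longleftrightarrow>
     {X, Y, Z} \<subseteq> lie_algebra A mul \<and>
     (\<forall>V\<in>lie_algebra A mul. \<exists>!(a, b, c). V = lincomb3 a b c X Y Z)"


section \<open>Lorentzian metrics\<close>

type_synonym 'a metric_field = "'a \<Rightarrow> 'a tvec \<Rightarrow> 'a tvec \<Rightarrow> real"

definition pseudo_orthonormal3 ::
    "('v \<Rightarrow> 'v \<Rightarrow> real) \<Rightarrow> 'v \<Rightarrow> 'v \<Rightarrow> 'v \<Rightarrow> bool" where
  "pseudo_orthonormal3 b x y z \<longleftrightarrow>
     b x x = 1 \<and> b y y = 1 \<and> b z z = -1 \<and>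
     b x y = 0 \<and> b y x = 0 \<and> b x z = 0 \<and> b z x = 0 \<and> b y z = 0 \<and> b z y = 0"

text \<open>
  On a three-dimensional tangent space, signature \<open>(+, +, -)\<close> amounts to the existence of a
  pseudo-orthonormal triple, which is then automatically a basis.
\<close>

definition lorentzian_metric ::
    "('a::topological_space, real^3) atlas \<Rightarrow> 'a metric_field \<Rightarrow> bool" where
  "lorentzian_metric A g \<longleftrightarrow>
     (\<forall>p. \<forall>u\<in>tangent_space A p. \<forall>v\<in>tangent_space A p. g p u v = g p v u) \<and>
     (\<forall>p. \<forall>u\<in>tangent_space A p. \<forall>v\<in>tangent_space A p. \<forall>w\<in>tangent_space A p. \<forall>c d.
        g p (tv_add (tv_scale c u) (tv_scale d v)) w = c * g p u w + d * g p v w) \<and>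
     (\<forall>p. \<exists>x\<in>tangent_space A p. \<exists>y\<in>tangent_space A p. \<exists>z\<in>tangent_space A p.
        pseudo_orthonormal3 (g p) x y z) \<and>
     (\<forall>X Y. vector_field A X \<longrightarrow> vector_field A Y \<longrightarrow> smooth_fun A (\<lambda>p. g p (X p) (Y p)))"

definition left_invariant_metric ::
    "('a::topological_space, 'e::euclidean_space) atlas \<Rightarrow> ('a \<Rightarrow> 'a \<Rightarrow> 'a)
      \<Rightarrow> 'a metric_field \<Rightarrow> bool" where
  "left_invariant_metric A mul g \<longleftrightarrow>
     (\<forall>a p. \<forall>u\<in>tangent_space A p. \<forall>v\<in>tangent_space A p.
        g (mul a p) (push_left mul a u) (push_left mul a v) = g p u v)"


section \<open>Levi-Civita connection, curvature, Riemann solitons\<close>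

type_synonym 'a connection = "'a vfield \<Rightarrow> 'a vfield \<Rightarrow> 'a vfield"
type_synonym 'a tensor2 = "'a vfield \<Rightarrow> 'a vfield \<Rightarrow> 'a \<Rightarrow> real"
type_synonym 'a tensor4 = "'a vfield \<Rightarrow> 'a vfield \<Rightarrow> 'a vfield \<Rightarrow> 'a vfield \<Rightarrow> 'a \<Rightarrow> real"

definition metric_tensor :: "'a metric_field \<Rightarrow> 'a tensor2" where
  "metric_tensor g X Y = (\<lambda>p. g p (X p) (Y p))"

definition affine_connection ::
    "('a::topological_space, 'e::euclidean_space) atlas \<Rightarrow> 'a connection \<Rightarrow> bool" where
  "affine_connection A D \<longleftrightarrow>
     (\<forall>X Y. vector_field A X \<longrightarrow> vector_field A Y \<longrightarrow> vector_field A (D X Y)) \<and>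
     (\<forall>X Y Z. vector_field A X \<longrightarrow> vector_field A Y \<longrightarrow> vector_field A Z \<longrightarrow>
        D (vf_add X Y) Z = vf_add (D X Z) (D Y Z) \<and>
        D X (vf_add Y Z) = vf_add (D X Y) (D X Z)) \<and>
     (\<forall>h X Y. smooth_fun A h \<longrightarrow> vector_field A X \<longrightarrow> vector_field A Y \<longrightarrow>
        D (vf_mult h X) Y = vf_mult h (D X Y) \<and>
        D X (vf_mult h Y) = vf_add (vf_mult (vf_app X h) Y) (vf_mult h (D X Y)))"

definition levi_civita ::
    "('a::topological_space, 'e::euclidean_space) atlas \<Rightarrow> 'a metric_field
      \<Rightarrow> 'a connection \<Rightarrow> bool" where
  "levi_civita A g D \<longleftrightarrow>
     affine_connection A D \<and>
     (\<forall>X Y. vector_field A X \<longrightarrow> vector_field A Y \<longrightarrow>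
        vf_diff (D X Y) (D Y X) = lie_bracket A X Y) \<and>
     (\<forall>X Y Z. vector_field A X \<longrightarrow> vector_field A Y \<longrightarrow> vector_field A Z \<longrightarrow>
        (\<forall>p. vf_app X (metric_tensor g Y Z) p =
               metric_tensor g (D X Y) Z p + metric_tensor g Y (D X Z) p))"

definition curvature ::
    "('a::topological_space, 'e::euclidean_space) atlas \<Rightarrow> 'a connection
      \<Rightarrow> 'a vfield \<Rightarrow> 'a vfield \<Rightarrow> 'a vfield \<Rightarrow> 'a vfield" where
  "curvature A D X Y Z =
     vf_diff (vf_diff (D X (D Y Z)) (D Y (D X Z))) (D (lie_bracket A X Y) Z)"

definition curvature_tensor ::
    "('a::topological_space, 'e::euclidean_space) atlas \<Rightarrow> 'a metric_field \<Rightarrow> 'a connection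
      \<Rightarrow> 'a tensor4" where
  "curvature_tensor A g D X Y Z W = (\<lambda>p. - metric_tensor g (curvature A D X Y Z) W p)"

definition kulkarni_nomizu :: "'a tensor2 \<Rightarrow> 'a tensor2 \<Rightarrow> 'a tensor4" where
  "kulkarni_nomizu S T X Y Z W =
     (\<lambda>p. S X W p * T Y Z p + S Y Z p * T X W p - S X Z p * T Y W p - S Y W p * T X Z p)"

text \<open>
  The derivation rule \<open>(L_V g)(Y, Z) = V (g(Y, Z)) - g([V, Y], Z) - g(Y, [V, Z])\<close> is taken as the
  definition of the Lie derivative, which avoids flows.
\<close>

definition lie_derivative_metric ::
    "('a::topological_space, 'e::euclidean_space) atlas \<Rightarrow> 'a metric_field \<Rightarrow> 'a vfield
      \<Rightarrow> 'a tensor2" where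
  "lie_derivative_metric A g V Y Z =
     (\<lambda>p. vf_app V (metric_tensor g Y Z) p
          - metric_tensor g (lie_bracket A V Y) Z p - metric_tensor g Y (lie_bracket A V Z) p)"

text \<open>
  The connection is a parameter; it is intended to be the Levi-Civita connection of the metric.
\<close>

definition left_invariant_riemann_soliton ::
    "('a::topological_space, 'e::euclidean_space) atlas \<Rightarrow> ('a \<Rightarrow> 'a \<Rightarrow> 'a)
      \<Rightarrow> 'a metric_field \<Rightarrow> 'a connection \<Rightarrow> 'a vfield \<Rightarrow> real \<Rightarrow> bool" where
  "left_invariant_riemann_soliton A mul g D V lam \<longleftrightarrow>
     V \<in> lie_algebra A mul \<and>
     (\<forall>X Y Z W p. vector_field A X \<longrightarrow> vector_field A Y \<longrightarrow> vector_field A Z \<longrightarrow>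
        vector_field A W \<longrightarrow>
        curvature_tensor A g D X Y Z W p
          + 1/2 * kulkarni_nomizu (lie_derivative_metric A g V) (metric_tensor g) X Y Z W p
        = lam / 2 * kulkarni_nomizu (metric_tensor g) (metric_tensor g) X Y Z W p)"

end

theory Submission
  imports Defs
begin

text \<open>
  Vector fields form a module over the smooth functions, and the pseudo-orthonormal frame is a basis
  of it. The Koszul formula determines the connection on the frame, so the soliton equation on
  the frame becomes polynomial: with \<open>\<sigma> = (\<beta> + \<gamma>) / 2\<close> and \<open>V = x e\<^sub>1 + y e\<^sub>2 + z e\<^sub>3\<close> it forces
  \<open>z = 0\<close> and then \<open>(\<alpha> - \<delta>)\<^sup>2 + 4 \<sigma>\<^sup>2 = 0\<close>; the remaining equations in \<open>x\<close> and \<open>y\<close> have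
  determinant \<open>\<alpha>\<^sup>2 + \<beta>\<^sup>2 \<noteq> 0\<close>. Conversely, if \<open>\<alpha> = \<delta>\<close> and \<open>\<beta> + \<gamma> = 0\<close> the metric has constant
  curvature \<open>\<alpha>\<^sup>2\<close>, which by tensoriality only has to be checked on the frame.
\<close>

section \<open>Smooth functions\<close>

lemma frechet_derivative_cong_open:
  assumes "open S" "x \<in> S" "\<And>y. y \<in> S \<Longrightarrow> f y = g y" "f differentiable (at x)"
  shows "g differentiable (at x)"
    and "frechet_derivative g (at x) = frechet_derivative f (at x)"
proof -
  have "(f has_derivative frechet_derivative f (at x)) (at x)"
    using assms(4) frechet_derivative_works by blast
  then have "(g has_derivative frechet_derivative f (at x)) (at x)"
    using has_derivative_transform_within_open assms(1-3) by blast
  then show "g differentiable (at x)"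
    and "frechet_derivative g (at x) = frechet_derivative f (at x)"
    by (auto simp: differentiable_def frechet_derivative_at[symmetric])
qed

text \<open>The induction runs over all \<open>f\<close> and \<open>g\<close> because the step
  passes to directional derivatives. Being local, these again agree on the open set
  \<open>S\<close>.\<close>

lemma Ck_on_cong:
  assumes "open S" "\<And>y. y \<in> S \<Longrightarrow> f y = g y" "Ck_on k f S"
  shows "Ck_on k g S"
  using assms(2,3)
proof (induction k arbitrary: f g)
  case 0
  then show ?case by (simp cong: continuous_on_cong)
next
  case (Suc k)
  have d: "f differentiable (at x)" if "x \<in> S" for x
    using Suc.prems that by simp
  have "g differentiable (at x)" if "x \<in> S" for x
    using frechet_derivative_cong_open(1)[OF assms(1) that Suc.prems(1) d[OF that]] by simp
  moreover have "Ck_on k (\<lambda>x. frechet_derivative g (at x) v) S" for v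
  proof (rule Suc.IH)
    show "Ck_on k (\<lambda>x. frechet_derivative f (at x) v) S"
      using Suc.prems by simp
    show "frechet_derivative f (at x) v = frechet_derivative g (at x) v" if "x \<in> S" for x
      using frechet_derivative_cong_open(2)[OF assms(1) that Suc.prems(1) d[OF that]] by simp
  qed
  ultimately show ?case by simp
qed

lemma Ck_on_Suc_imp: "Ck_on (Suc k) f S \<Longrightarrow> Ck_on k f S"
proof (induction k arbitrary: f)
  case 0
  then show ?case
    by (auto intro!: continuous_at_imp_continuous_on differentiable_imp_continuous_within)
next
  case (Suc k)
  then show ?case by (metis Ck_on.simps(2))
qed

lemma Ck_on_const: "Ck_on k (\<lambda>x. c) S"
  by (induction k arbitrary: c) simp_all

lemma Ck_on_add:
  assumes "open S" "Ck_on k f S" "Ck_on k g S"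
  shows "Ck_on k (\<lambda>x. f x + g x) S"
  using assms(2,3)
proof (induction k arbitrary: f g)
  case 0
  then show ?case by (simp add: continuous_on_add)
next
  case (Suc k)
  have "Ck_on k (\<lambda>x. frechet_derivative (\<lambda>x. f x + g x) (at x) v) S" for v
  \<comment> \<open>The sum rule is available only at points of \<open>S\<close>, where both
    summands are known to be differentiable; hence the detour through
    \<open>Ck_on_cong\<close>.\<close>
  proof (rule Ck_on_cong[OF assms(1)])
    show "Ck_on k (\<lambda>x. frechet_derivative f (at x) v + frechet_derivative g (at x) v) S"
      by (rule Suc.IH) (use Suc.prems in simp_all)
    show "frechet_derivative f (at x) v + frechet_derivative g (at x) v
        = frechet_derivative (\<lambda>x. f x + g x) (at x) v" if "x \<in> S" for x
    proof -
      have "f differentiable (at x)" "g differentiable (at x)"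
        using Suc.prems that by simp_all
      then have "((\<lambda>x. f x + g x) has_derivative
          (\<lambda>v. frechet_derivative f (at x) v + frechet_derivative g (at x) v)) (at x)"
        by (intro has_derivative_add) (simp_all flip: frechet_derivative_works)
      from fun_cong[OF frechet_derivative_at[OF this]] show ?thesis .
    qed
  qed
  with Suc.prems show ?case by simp
qed

lemma Ck_on_mult:
  fixes f g :: "'a::euclidean_space \<Rightarrow> real"
  assumes "open S" "Ck_on k f S" "Ck_on k g S"
  shows "Ck_on k (\<lambda>x. f x * g x) S"
  using assms(2,3)
proof (induction k arbitrary: f g)
  case 0
  then show ?case by (simp add: continuous_on_mult)
next
  case (Suc k)
  have "Ck_on k (\<lambda>x. frechet_derivative (\<lambda>x. f x * g x) (at x) v) S" for v
  proof (rule Ck_on_cong[OF assms(1)])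
    \<comment> \<open>By Leibniz each product pairs a derivative of class \<open>k\<close> with a
      factor lowered from \<open>Suc k\<close> to \<open>k\<close>, so the induction hypothesis
      covers both.\<close>
    show "Ck_on k (\<lambda>x. f x * frechet_derivative g (at x) v
                      + frechet_derivative f (at x) v * g x) S"
      by (intro Ck_on_add assms(1) Suc.IH Suc.prems[THEN Ck_on_Suc_imp])
        (use Suc.prems in simp_all)
    show "f x * frechet_derivative g (at x) v + frechet_derivative f (at x) v * g x
        = frechet_derivative (\<lambda>x. f x * g x) (at x) v" if "x \<in> S" for x
    proof -
      have "f differentiable (at x)" "g differentiable (at x)"
        using Suc.prems that by simp_all
      then have "((\<lambda>x. f x * g x) has_derivative
          (\<lambda>v. f x * frechet_derivative g (at x) v + frechet_derivative f (at x) v * g x)) (at x)"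
        by (intro has_derivative_mult) (simp_all flip: frechet_derivative_works)
      from fun_cong[OF frechet_derivative_at[OF this]] show ?thesis .
    qed
  qed
  with Suc.prems show ?case by simp
qed

lemma smooth_on_imp_differentiable:
  assumes "smooth_on f S" "x \<in> S"
  shows "f differentiable (at x)"
proof -
  have "Ck_on (Suc 0) f S" using assms(1) unfolding smooth_on_def by blast
  with assms(2) show ?thesis by simp
qed

section \<open>Charts and smooth functions on the manifold\<close>

lemma smooth_atlas_chart: "smooth_atlas A \<Longrightarrow> (U, \<phi>) \<in> A \<Longrightarrow> is_chart U \<phi>"
  unfolding smooth_atlas_def by auto

lemma smooth_atlas_cover:
  assumes "smooth_atlas A"
  obtains U \<phi> where "(U, \<phi>) \<in> A" "p \<in> U"
proof -
  have "p \<in> (\<Union>(U, \<phi>)\<in>A. U)"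
    using assms unfolding smooth_atlas_def by simp
  with that show ?thesis by auto
qed

lemma is_chart_inv_into: "is_chart U \<phi> \<Longrightarrow> x \<in> U \<Longrightarrow> inv_into U \<phi> (\<phi> x) = x"
  unfolding is_chart_def homeomorphism_def by simp

lemma is_chart_open_image:
  assumes "is_chart U \<phi>" "open W"
  shows "open (\<phi> ` (U \<inter> W))"
proof -
  have "openin (top_of_set (\<phi> ` U)) (\<phi> ` (U \<inter> W))"
    using assms homeomorphism_imp_open_map unfolding is_chart_def
    by (metis openin_open_Int)
  then show ?thesis
    using assms(1) unfolding is_chart_def by (simp add: openin_open_eq)
qed

lemma smooth_fun_onI:
  assumes "\<And>U \<phi> k. (U, \<phi>) \<in> A \<Longrightarrow> Ck_on k (\<lambda>x. f (inv_into U \<phi> x)) (\<phi> ` (U \<inter> W))"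
  shows "smooth_fun_on A W f"
  using assms unfolding smooth_fun_on_def smooth_on_def comp_def by auto

lemma smooth_fun_onD:
  assumes "smooth_fun_on A W f" "(U, \<phi>) \<in> A"
  shows "Ck_on k (\<lambda>x. f (inv_into U \<phi> x)) (\<phi> ` (U \<inter> W))"
  using assms unfolding smooth_fun_on_def smooth_on_def comp_def by auto

lemma smooth_fun_on_const: "smooth_fun_on A W (\<lambda>x. c)"
  unfolding smooth_fun_on_def smooth_on_def comp_def by (auto simp: Ck_on_const)

lemma smooth_fun_on_add:
  assumes "smooth_atlas A" "open W" "smooth_fun_on A W f" "smooth_fun_on A W h"
  shows "smooth_fun_on A W (\<lambda>x. f x + h x)"
  using assms(3,4) is_chart_open_image[OF smooth_atlas_chart[OF assms(1)] assms(2)]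
  by (auto intro!: smooth_fun_onI Ck_on_add dest: smooth_fun_onD)

lemma smooth_fun_on_mult:
  assumes "smooth_atlas A" "open W" "smooth_fun_on A W f" "smooth_fun_on A W h"
  shows "smooth_fun_on A W (\<lambda>x. f x * h x)"
  using assms(3,4) is_chart_open_image[OF smooth_atlas_chart[OF assms(1)] assms(2)]
  by (auto intro!: smooth_fun_onI Ck_on_mult dest: smooth_fun_onD)

lemma smooth_fun_on_subset:
  assumes "W \<subseteq> W'" "smooth_fun_on A W' f"
  shows "smooth_fun_on A W f"
proof -
  have mono: "Ck_on k h T" if "Ck_on k h S" "T \<subseteq> S"
    for k S T and h :: "'b \<Rightarrow> real"
    using that by (induction k arbitrary: h) (auto intro: continuous_on_subset)
  show ?thesis
  proof (rule smooth_fun_onI)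
    fix U \<phi> k
    assume "(U, \<phi>) \<in> A"
    then show "Ck_on k (\<lambda>x. f (inv_into U \<phi> x)) (\<phi> ` (U \<inter> W))"
      by (rule mono[OF smooth_fun_onD[OF assms(2)]]) (use assms(1) in blast)
  qed
qed

lemma smooth_fun_const: "smooth_fun A (\<lambda>x. c)"
  unfolding smooth_fun_def by (rule smooth_fun_on_const)

lemma smooth_fun_imp_near: "smooth_fun A f \<Longrightarrow> smooth_near A p f"
  unfolding smooth_fun_def smooth_near_def by (rule exI[of _ UNIV]) simp

section \<open>Tangent spaces\<close>

text \<open>Names the derivations that \<open>tangent_space\<close> collects, one chart at a time,
  so that their linear dependence on \<xi> can be stated.\<close>

definition chart_vector ::
    "('a::topological_space, 'e::euclidean_space) atlas \<Rightarrow> 'a \<Rightarrow> 'a set \<Rightarrow> ('a \<Rightarrow> 'e) \<Rightarrow> 'e \<Rightarrow> 'a tvec" where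
  "chart_vector A p U \<phi> \<xi> = (\<lambda>f. if smooth_near A p f
     then frechet_derivative (f \<circ> inv_into U \<phi>) (at (\<phi> p)) \<xi> else 0)"

lemma smooth_near_differentiable:
  assumes "smooth_near A p f" "(U, \<phi>) \<in> A" "p \<in> U"
  shows "(f \<circ> inv_into U \<phi>) differentiable (at (\<phi> p))"
proof -
  obtain W where W: "p \<in> W" "smooth_fun_on A W f"
    using assms(1) unfolding smooth_near_def by blast
  show ?thesis
  proof (rule smooth_on_imp_differentiable)
    show "smooth_on (f \<circ> inv_into U \<phi>) (\<phi> ` (U \<inter> W))"
      using W(2) assms(2) unfolding smooth_fun_on_def by auto
    show "\<phi> p \<in> \<phi> ` (U \<inter> W)"
      using W(1) assms(3) by blast
  qed
qed

lemma chart_vector_linear: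
  assumes "(U, \<phi>) \<in> A" "p \<in> U"
  shows "chart_vector A p U \<phi> (\<xi> + \<eta>) = tv_add (chart_vector A p U \<phi> \<xi>) (chart_vector A p U \<phi> \<eta>)"
    and "chart_vector A p U \<phi> (c *\<^sub>R \<xi>) = tv_scale c (chart_vector A p U \<phi> \<xi>)"
proof -
  have "linear (frechet_derivative (f \<circ> inv_into U \<phi>) (at (\<phi> p)))" if "smooth_near A p f" for f
    using smooth_near_differentiable[OF that assms] linear_frechet_derivative by blast
  then show "chart_vector A p U \<phi> (\<xi> + \<eta>) = tv_add (chart_vector A p U \<phi> \<xi>) (chart_vector A p U \<phi> \<eta>)"
    and "chart_vector A p U \<phi> (c *\<^sub>R \<xi>) = tv_scale c (chart_vector A p U \<phi> \<xi>)"
    unfolding chart_vector_def tv_add_def tv_scale_def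
    by (auto simp: linear_add linear_scale)
qed

text \<open>This is the chain rule for the transition map. On functions not smooth near
  \<open>p\<close> both sides are 0 by convention.\<close>

lemma chart_vector_change:
  assumes "smooth_atlas A" "(U, \<phi>) \<in> A" "p \<in> U" "(V, \<psi>) \<in> A" "p \<in> V"
  shows "chart_vector A p V \<psi> \<eta>
    = chart_vector A p U \<phi> (frechet_derivative (\<phi> \<circ> inv_into V \<psi>) (at (\<psi> p)) \<eta>)"
proof -
  note cU = smooth_atlas_chart[OF assms(1,2)] and cV = smooth_atlas_chart[OF assms(1,4)]
  let ?S = "\<psi> ` (V \<inter> U)"
  let ?\<tau> = "\<phi> \<circ> inv_into V \<psi>"
  have S: "open ?S" "\<psi> p \<in> ?S"
    using is_chart_open_image[OF cV] cU assms(3,5) unfolding is_chart_def by auto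
  have "smooth_on ?\<tau> ?S"
    using assms(1,2,4) unfolding smooth_atlas_def by auto
  then have \<tau>: "(?\<tau> has_derivative frechet_derivative ?\<tau> (at (\<psi> p))) (at (\<psi> p))"
    using smooth_on_imp_differentiable S(2) frechet_derivative_works by blast
  have "frechet_derivative (f \<circ> inv_into V \<psi>) (at (\<psi> p)) \<eta>
      = frechet_derivative (f \<circ> inv_into U \<phi>) (at (\<phi> p)) (frechet_derivative ?\<tau> (at (\<psi> p)) \<eta>)"
    if f: "smooth_near A p f" for f
  proof -
    let ?F = "f \<circ> inv_into U \<phi>"
    have "(?F has_derivative frechet_derivative ?F (at (\<phi> p))) (at (\<phi> p))"
      using smooth_near_differentiable[OF f assms(2,3)] frechet_derivative_works by blast
    then have "(?F \<circ> ?\<tau> has_derivative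
        frechet_derivative ?F (at (\<phi> p)) \<circ> frechet_derivative ?\<tau> (at (\<psi> p))) (at (\<psi> p))"
      by (intro diff_chain_at \<tau>) (simp add: is_chart_inv_into[OF cV assms(5)])
    moreover have "(?F \<circ> ?\<tau>) y = (f \<circ> inv_into V \<psi>) y" if "y \<in> ?S" for y
      using that by (auto simp: is_chart_inv_into[OF cV] is_chart_inv_into[OF cU])
    ultimately have "(f \<circ> inv_into V \<psi> has_derivative
        frechet_derivative ?F (at (\<phi> p)) \<circ> frechet_derivative ?\<tau> (at (\<psi> p))) (at (\<psi> p))"
      using has_derivative_transform_within_open S by blast
    from fun_cong[OF frechet_derivative_at[OF this], of \<eta>] show ?thesis by simp
  qed
  then show ?thesis unfolding chart_vector_def by auto
qed

text \<open>By the change of chart, one chart already yields every tangent vector, so the tangent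
  space is a linear image of the model space. Closure under sums and the dimension count for frames
  rest on this.\<close>

lemma tangent_space_eq_range:
  assumes "smooth_atlas A" "(U, \<phi>) \<in> A" "p \<in> U"
  shows "tangent_space A p = range (chart_vector A p U \<phi>)"
proof -
  have "tangent_space A p
      = {chart_vector A p V \<psi> \<eta> | V \<psi> \<eta>. (V, \<psi>) \<in> A \<and> p \<in> V}"
    unfolding tangent_space_def chart_vector_def by simp
  moreover have "chart_vector A p V \<psi> \<eta> \<in> range (chart_vector A p U \<phi>)"
    if "(V, \<psi>) \<in> A" "p \<in> V" for V \<psi> \<eta>
    unfolding chart_vector_change[OF assms that] by (rule rangeI)
  ultimately show ?thesis
    using assms(2,3) by auto
qed

lemma tangent_space_add:
  assumes "smooth_atlas A" "v \<in> tangent_space A p" "w \<in> tangent_space A p"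
  shows "tv_add v w \<in> tangent_space A p"
proof -
  obtain U \<phi> where U: "(U, \<phi>) \<in> A" "p \<in> U" using smooth_atlas_cover[OF assms(1)] .
  show ?thesis
    using assms(2,3) chart_vector_linear(1)[OF U, symmetric]
    unfolding tangent_space_eq_range[OF assms(1) U] by auto
qed

lemma tangent_space_scale:
  assumes "smooth_atlas A" "v \<in> tangent_space A p"
  shows "tv_scale c v \<in> tangent_space A p"
proof -
  obtain U \<phi> where U: "(U, \<phi>) \<in> A" "p \<in> U" using smooth_atlas_cover[OF assms(1)] .
  show ?thesis
    using assms(2) chart_vector_linear(2)[OF U, symmetric]
    unfolding tangent_space_eq_range[OF assms(1) U] by auto
qed

lemma tangent_space_const: "v \<in> tangent_space A p \<Longrightarrow> v (\<lambda>x. c) = 0"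
  unfolding tangent_space_def by (auto simp: comp_def)

lemma vector_field_tangent: "vector_field A X \<Longrightarrow> X p \<in> tangent_space A p"
  unfolding vector_field_def by blast

lemma vector_field_app: "vector_field A X \<Longrightarrow> smooth_fun A h \<Longrightarrow> smooth_fun A (vf_app X h)"
  unfolding vector_field_def smooth_fun_def vf_app_def by blast

lemma vector_field_app_const: "vector_field A X \<Longrightarrow> vf_app X (\<lambda>x. c) = (\<lambda>x. 0)"
  unfolding vf_app_def by (rule ext, rule tangent_space_const, rule vector_field_tangent)

lemma vector_field_add:
  assumes "smooth_atlas A" "vector_field A X" "vector_field A Y"
  shows "vector_field A (vf_add X Y)"
  using assms(2,3) tangent_space_add[OF assms(1)] smooth_fun_on_add[OF assms(1)]
  unfolding vector_field_def vf_add_def tv_add_def by simp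

lemma vector_field_mult:
  assumes "smooth_atlas A" "smooth_fun A h" "vector_field A X"
  shows "vector_field A (vf_mult h X)"
proof -
  have "smooth_fun_on A W h" for W
    by (rule smooth_fun_on_subset[OF subset_UNIV assms(2)[unfolded smooth_fun_def]])
  then show ?thesis
    using assms(3) tangent_space_scale[OF assms(1)] smooth_fun_on_mult[OF assms(1)]
    unfolding vector_field_def vf_mult_def tv_scale_def by simp
qed

lemma vf_diff_eq: "vf_diff X Y = vf_add X (vf_mult (\<lambda>_. -1) Y)"
  unfolding vf_diff_def vf_add_def vf_mult_def ..

lemma vector_field_diff:
  assumes "smooth_atlas A" "vector_field A X" "vector_field A Y"
  shows "vector_field A (vf_diff X Y)"
  unfolding vf_diff_eq
  by (intro vector_field_add vector_field_mult assms smooth_fun_const)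

section \<open>Tensoriality of the curvature\<close>

lemmas vf_ops = vf_add_def vf_diff_def vf_mult_def tv_add_def tv_scale_def

locale torsion_free_connection =
  fixes A :: "('a::{t2_space, second_countable_topology}, 'e::euclidean_space) atlas"
    and D :: "'a connection"
  assumes atlas: "smooth_atlas A"
    and connection: "affine_connection A D"
    and torsion_free: "\<And>X Y. vector_field A X \<Longrightarrow> vector_field A Y \<Longrightarrow>
      vf_diff (D X Y) (D Y X) = lie_bracket A X Y"
begin

lemma vf_D [simp]: "vector_field A X \<Longrightarrow> vector_field A Y \<Longrightarrow> vector_field A (D X Y)"
  using connection unfolding affine_connection_def by simp

lemmas vf_closed [simp] =
  vector_field_add[OF atlas] vector_field_mult[OF atlas] vector_field_diff[OF atlas]
  vector_field_app smooth_fun_const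

text \<open>Torsion-freeness writes the bracket as a difference of two covariant derivatives, so no
  second derivatives have to be examined.\<close>

lemma vf_bracket [simp]:
  "vector_field A X \<Longrightarrow> vector_field A Y \<Longrightarrow> vector_field A (lie_bracket A X Y)"
  using torsion_free[of X Y, symmetric] by simp

lemma D_add_left:
  "vector_field A X \<Longrightarrow> vector_field A Y \<Longrightarrow> vector_field A Z \<Longrightarrow>
    D (vf_add X Y) Z = vf_add (D X Z) (D Y Z)"
  using connection unfolding affine_connection_def by simp

lemma D_add_right:
  "vector_field A X \<Longrightarrow> vector_field A Y \<Longrightarrow> vector_field A Z \<Longrightarrow>
    D X (vf_add Y Z) = vf_add (D X Y) (D X Z)"
  using connection unfolding affine_connection_def by simp

lemma D_mult_left:
  "smooth_fun A h \<Longrightarrow> vector_field A X \<Longrightarrow> vector_field A Y \<Longrightarrow>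
    D (vf_mult h X) Y = vf_mult h (D X Y)"
  using connection unfolding affine_connection_def by simp

lemma D_mult_right:
  "smooth_fun A h \<Longrightarrow> vector_field A X \<Longrightarrow> vector_field A Y \<Longrightarrow>
    D X (vf_mult h Y) = vf_add (vf_mult (vf_app X h) Y) (vf_mult h (D X Y))"
  using connection unfolding affine_connection_def by simp

lemma D_const_right:
  "vector_field A X \<Longrightarrow> vector_field A Y \<Longrightarrow>
    D X (vf_mult (\<lambda>_. c) Y) = vf_mult (\<lambda>_. c) (D X Y)"
  by (simp add: D_mult_right vector_field_app_const) (simp add: vf_ops)

lemma D_diff_left:
  "vector_field A X \<Longrightarrow> vector_field A Y \<Longrightarrow> vector_field A Z \<Longrightarrow>
    D (vf_diff X Y) Z = vf_diff (D X Z) (D Y Z)"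
  unfolding vf_diff_eq by (simp add: D_add_left D_mult_left)

lemma lincomb3_eq:
  "lincomb3 a b c X Y Z
    = vf_add (vf_add (vf_mult (\<lambda>_. a) X) (vf_mult (\<lambda>_. b) Y)) (vf_mult (\<lambda>_. c) Z)"
  by (simp add: vf_ops lincomb3_def)

lemma vf_lincomb3 [simp]:
  "vector_field A X \<Longrightarrow> vector_field A Y \<Longrightarrow> vector_field A Z \<Longrightarrow>
    vector_field A (lincomb3 a b c X Y Z)"
  by (simp add: lincomb3_eq)

lemma D_lincomb3_left:
  "vector_field A X \<Longrightarrow> vector_field A Y \<Longrightarrow> vector_field A Z \<Longrightarrow> vector_field A W \<Longrightarrow>
    D (lincomb3 a b c X Y Z) W = lincomb3 a b c (D X W) (D Y W) (D Z W)"
  by (simp add: lincomb3_eq D_add_left D_mult_left)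

lemma D_lincomb3_right:
  "vector_field A X \<Longrightarrow> vector_field A Y \<Longrightarrow> vector_field A Z \<Longrightarrow> vector_field A W \<Longrightarrow>
    D W (lincomb3 a b c X Y Z) = lincomb3 a b c (D W X) (D W Y) (D W Z)"
  by (simp add: lincomb3_eq D_add_right D_const_right)

text \<open>The Leibniz rule of \<open>D\<close> carries over once torsion-freeness has expressed
  the bracket through \<open>D\<close>. The first simplification works with whole fields; the second
  unfolds the operations pointwise and collects terms.\<close>

lemma bracket_mult_left:
  assumes "smooth_fun A h" "vector_field A X" "vector_field A Y"
  shows "lie_bracket A (vf_mult h X) Y
    = vf_diff (vf_mult h (lie_bracket A X Y)) (vf_mult (vf_app Y h) X)"
  using assms by (simp add: D_mult_left D_mult_right flip: torsion_free)
    (simp add: vf_ops fun_eq_iff algebra_simps)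

lemma bracket_add_left:
  assumes "vector_field A X" "vector_field A X'" "vector_field A Y"
  shows "lie_bracket A (vf_add X X') Y = vf_add (lie_bracket A X Y) (lie_bracket A X' Y)"
  using assms by (simp add: D_add_left D_add_right flip: torsion_free)
    (simp add: vf_ops fun_eq_iff algebra_simps)

lemma bracket_swap:
  "vector_field A X \<Longrightarrow> vector_field A Y \<Longrightarrow>
    lie_bracket A Y X = vf_mult (\<lambda>_. -1) (lie_bracket A X Y)"
  by (simp flip: torsion_free) (simp add: vf_ops fun_eq_iff algebra_simps)

lemma curvature_swap:
  assumes "vector_field A X" "vector_field A Y" "vector_field A Z"
  shows "curvature A D Y X Z = vf_mult (\<lambda>_. -1) (curvature A D X Y Z)"
  using assms by (simp add: curvature_def bracket_swap[of X Y] D_mult_left)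
    (simp add: vf_ops fun_eq_iff algebra_simps)

text \<open>The term with \<open>vf_app Y h\<close> that arises from differentiating
  \<open>vf_mult h (D X Z)\<close> along \<open>Y\<close> cancels against the one from the bracket
  of \<open>vf_mult h X\<close> with \<open>Y\<close>.\<close>

lemma curvature_mult_1:
  assumes "smooth_fun A h" "vector_field A X" "vector_field A Y" "vector_field A Z"
  shows "curvature A D (vf_mult h X) Y Z = vf_mult h (curvature A D X Y Z)"
  using assms
  by (simp add: curvature_def bracket_mult_left D_mult_left D_mult_right D_diff_left)
    (simp add: vf_ops fun_eq_iff algebra_simps)

lemma curvature_add_1:
  assumes "vector_field A X" "vector_field A X'" "vector_field A Y" "vector_field A Z"
  shows "curvature A D (vf_add X X') Y Z = vf_add (curvature A D X Y Z) (curvature A D X' Y Z)"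
  using assms by (simp add: curvature_def bracket_add_left D_add_left D_add_right)
    (simp add: vf_ops fun_eq_iff algebra_simps)

text \<open>First-order terms in \<open>h\<close> cancel by symmetry in \<open>X\<close> and
  \<open>Y\<close>; the second-order ones form a commutator, which the bracket term absorbs.\<close>

lemma curvature_mult_3:
  assumes "smooth_fun A h" "vector_field A X" "vector_field A Y" "vector_field A Z"
  shows "curvature A D X Y (vf_mult h Z) = vf_mult h (curvature A D X Y Z)"
proof -
  \<comment> \<open>\<open>lie_bracket\<close> defaults to 0 on functions not smooth near
    \<open>p\<close>, so smoothness of \<open>h\<close> is what allows unfolding it to the
    commutator.\<close>
  have XY: "X p (\<lambda>q. Y q h) = lie_bracket A X Y p h + Y p (\<lambda>q. X q h)" for p
    using smooth_fun_imp_near[OF assms(1)] by (simp add: vf_app_def lie_bracket_def)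
  show ?thesis
    using assms by (simp add: curvature_def D_add_right D_mult_right)
      (simp add: vf_ops fun_eq_iff algebra_simps vf_app_def XY)
qed

lemma curvature_add_3:
  assumes "vector_field A X" "vector_field A Y" "vector_field A Z" "vector_field A Z'"
  shows "curvature A D X Y (vf_add Z Z') = vf_add (curvature A D X Y Z) (curvature A D X Y Z')"
  using assms by (simp add: curvature_def D_add_right)
    (simp add: vf_ops fun_eq_iff algebra_simps)

end

section \<open>Pseudo-orthonormal frames\<close>

locale lorentz_frame =
  fixes A :: "('a::{t2_space, second_countable_topology}, real^3) atlas"
    and g :: "'a metric_field" and e1 e2 e3 :: "'a vfield"
  assumes smooth_atlas: "smooth_atlas A"
    and lorentzian: "lorentzian_metric A g"
    and vf_frame [simp]: "vector_field A e1" "vector_field A e2" "vector_field A e3"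
    and orthonormal: "\<And>p. pseudo_orthonormal3 (g p) (e1 p) (e2 p) (e3 p)"
begin

lemma metric_sym:
  "v \<in> tangent_space A p \<Longrightarrow> w \<in> tangent_space A p \<Longrightarrow> g p v w = g p w v"
  using lorentzian unfolding lorentzian_metric_def by blast

lemma metric_lincomb2:
  assumes "v \<in> tangent_space A p" "v' \<in> tangent_space A p" "w \<in> tangent_space A p"
  shows "g p (tv_add (tv_scale c v) (tv_scale d v')) w = c * g p v w + d * g p v' w"
  using lorentzian assms unfolding lorentzian_metric_def by blast

lemma metric_lincomb3:
  assumes "v1 \<in> tangent_space A p" "v2 \<in> tangent_space A p" "v3 \<in> tangent_space A p"
    "w \<in> tangent_space A p"
  shows "g p (\<lambda>f. a * v1 f + b * v2 f + c * v3 f) w = a * g p v1 w + b * g p v2 w + c * g p v3 w"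
proof -
  let ?v = "tv_add (tv_scale a v1) (tv_scale b v2)"
  have "?v \<in> tangent_space A p"
    using assms by (intro tangent_space_add tangent_space_scale smooth_atlas)
  \<comment> \<open>The axiom covers two summands; the coefficient 1 lets it be applied
    twice.\<close>
  then have "g p (tv_add (tv_scale 1 ?v) (tv_scale c v3)) w
      = a * g p v1 w + b * g p v2 w + c * g p v3 w"
    using assms by (simp add: metric_lincomb2)
  then show ?thesis by (simp add: tv_add_def tv_scale_def)
qed

lemma frame_tangent [simp]:
  "e1 p \<in> tangent_space A p" "e2 p \<in> tangent_space A p" "e3 p \<in> tangent_space A p"
  using vf_frame by (auto intro: vector_field_tangent)

lemma metric_frame [simp]:
  "g p (e1 p) (e1 p) = 1" "g p (e2 p) (e2 p) = 1" "g p (e3 p) (e3 p) = -1"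
  "g p (e1 p) (e2 p) = 0" "g p (e2 p) (e1 p) = 0" "g p (e1 p) (e3 p) = 0"
  "g p (e3 p) (e1 p) = 0" "g p (e2 p) (e3 p) = 0" "g p (e3 p) (e2 p) = 0"
  using orthonormal[of p] unfolding pseudo_orthonormal3_def by auto

text \<open>The frame is independent because it is pseudo-orthonormal, hence spans by dimension.\<close>

lemma tangent_expansion:
  assumes "v \<in> tangent_space A p"
  shows "v = (\<lambda>f. g p v (e1 p) * e1 p f + g p v (e2 p) * e2 p f + - g p v (e3 p) * e3 p f)"
proof -
  obtain U \<phi> where U: "(U, \<phi>) \<in> A" "p \<in> U" using smooth_atlas_cover[OF smooth_atlas] .
  let ?T = "chart_vector A p U \<phi>"
  note range = tangent_space_eq_range[OF smooth_atlas U]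
  obtain \<xi>1 \<xi>2 \<xi>3 \<eta> where
    \<xi>: "e1 p = ?T \<xi>1" "e2 p = ?T \<xi>2" "e3 p = ?T \<xi>3" and \<eta>: "v = ?T \<eta>"
    using frame_tangent[of p] assms unfolding range by (metis rangeE)
  \<comment> \<open>\<open>F\<close> sends coefficients to the chart components of the combination
    of frame vectors. As a linear endomorphism of three-space it is onto as soon as it is
    injective.\<close>
  define F where "F a = a $ 1 *\<^sub>R \<xi>1 + a $ 2 *\<^sub>R \<xi>2 + a $ 3 *\<^sub>R \<xi>3" for a :: "real^3"
  have TF: "?T (F a) = (\<lambda>f. a $ 1 * e1 p f + a $ 2 * e2 p f + a $ 3 * e3 p f)" for a
    unfolding F_def chart_vector_linear[OF U] \<xi> by (simp add: tv_add_def tv_scale_def)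
  have g: "g p (?T (F a)) (e1 p) = a $ 1" "g p (?T (F a)) (e2 p) = a $ 2"
    "g p (?T (F a)) (e3 p) = - a $ 3" for a
    unfolding TF by (simp_all add: metric_lincomb3)
  have lin: "linear F"
    unfolding F_def by (intro linearI) (simp_all add: algebra_simps)
  \<comment> \<open>Pairing with the frame recovers the coefficients, up to sign for the timelike
    \<open>e3\<close>.\<close>
  have "inj F"
  proof (rule injI)
    fix a b assume "F a = F b"
    then have "a $ 1 = b $ 1" "a $ 2 = b $ 2" "- a $ 3 = - b $ 3"
      using g by metis+
    then show "a = b" by (simp add: vec_eq_iff forall_3)
  qed
  then obtain a where "\<eta> = F a"
    using linear_injective_imp_surjective[OF lin] by (metis surjD)
  with \<eta> have v: "v = ?T (F a)" by simp
  show ?thesis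
    using TF[of a] g[of a] unfolding v by simp
qed

section \<open>The metric on vector fields and induction over the frame\<close>

lemma smooth_metric:
  "vector_field A X \<Longrightarrow> vector_field A Y \<Longrightarrow> smooth_fun A (metric_tensor g X Y)"
  using lorentzian unfolding lorentzian_metric_def metric_tensor_def by blast

lemma metric_tensor_add_left:
  assumes "vector_field A X" "vector_field A Y" "vector_field A Z"
  shows "metric_tensor g (vf_add X Y) Z = (\<lambda>p. metric_tensor g X Z p + metric_tensor g Y Z p)"
  using metric_lincomb2[OF assms[THEN vector_field_tangent], of _ 1 1]
  by (simp add: metric_tensor_def vf_ops fun_eq_iff)

lemma metric_tensor_mult_left:
  assumes "vector_field A X" "vector_field A Z"
  shows "metric_tensor g (vf_mult h X) Z = (\<lambda>p. h p * metric_tensor g X Z p)"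
  \<comment> \<open>The coefficient 0 removes the second summand of the two-term linearity
    axiom.\<close>
  using metric_lincomb2[OF assms(1,1,2)[THEN vector_field_tangent], of _ "h _" 0]
  by (simp add: metric_tensor_def vf_ops fun_eq_iff)

lemma metric_tensor_sym:
  "vector_field A X \<Longrightarrow> vector_field A Y \<Longrightarrow> metric_tensor g X Y = metric_tensor g Y X"
  unfolding metric_tensor_def by (intro ext metric_sym) (simp_all add: vector_field_tangent)

lemma metric_tensor_add_right:
  assumes "vector_field A X" "vector_field A Y" "vector_field A Z"
  shows "metric_tensor g Z (vf_add X Y) = (\<lambda>p. metric_tensor g Z X p + metric_tensor g Z Y p)"
  using metric_tensor_add_left[OF assms] assms
  by (simp add: metric_tensor_sym[of Z] vector_field_add[OF smooth_atlas])

lemma metric_tensor_mult_right: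
  assumes "smooth_fun A h" "vector_field A X" "vector_field A Z"
  shows "metric_tensor g Z (vf_mult h X) = (\<lambda>p. h p * metric_tensor g Z X p)"
  using metric_tensor_mult_left[OF assms(2,3)] assms
  by (simp add: metric_tensor_sym[of Z] vector_field_mult[OF smooth_atlas])

text \<open>The coefficients of \<open>X\<close> in the frame are, up to sign, its inner products
  with \<open>e1\<close>, \<open>e2\<close>, \<open>e3\<close>, which are smooth functions. A
  property stable under the module operations thus needs checking on three fields only.\<close>

lemma frame_induct [consumes 1, case_names add mult e1 e2 e3]:
  assumes "vector_field A X"
    and add: "\<And>Y Z. vector_field A Y \<Longrightarrow> vector_field A Z \<Longrightarrow> P Y \<Longrightarrow> P Z \<Longrightarrow> P (vf_add Y Z)"
    and mult: "\<And>h Y. smooth_fun A h \<Longrightarrow> vector_field A Y \<Longrightarrow> P Y \<Longrightarrow> P (vf_mult h Y)"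
    and "P e1" "P e2" "P e3"
  shows "P X"
proof -
  let ?c = "\<lambda>e. metric_tensor g X e"
  \<comment> \<open>The third coefficient carries the sign of the timelike \<open>e3\<close>,
    supplied as a constant multiple so that \<open>mult\<close> applies to it.\<close>
  have "X p = vf_add (vf_add (vf_mult (?c e1) e1) (vf_mult (?c e2) e2))
      (vf_mult (\<lambda>_. -1) (vf_mult (?c e3) e3)) p" for p
    by (subst tangent_expansion[OF vector_field_tangent[OF assms(1)]])
      (simp add: vf_ops metric_tensor_def)
  then have "X = vf_add (vf_add (vf_mult (?c e1) e1) (vf_mult (?c e2) e2))
      (vf_mult (\<lambda>_. -1) (vf_mult (?c e3) e3))" ..
  moreover have "P \<dots>"
    using assms
    by (intro add mult smooth_metric smooth_fun_const
        vector_field_add[OF smooth_atlas] vector_field_mult[OF smooth_atlas]) simp_all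
  ultimately show ?thesis by simp
qed

text \<open>The axioms grant linearity in the first slot; the second slot is reached by
  symmetry.\<close>

lemma metric_frame_lincomb:
  "metric_tensor g (lincomb3 a b c e1 e2 e3) (lincomb3 a' b' c' e1 e2 e3) p
    = a * a' + b * b' - c * c'"
proof -
  have t: "lincomb3 x y z e1 e2 e3 p \<in> tangent_space A p" for x y z
  proof -
    have "lincomb3 x y z e1 e2 e3 p
        = tv_add (tv_add (tv_scale x (e1 p)) (tv_scale y (e2 p))) (tv_scale z (e3 p))"
      by (simp add: lincomb3_def tv_add_def tv_scale_def)
    then show ?thesis
      by (simp add: tangent_space_add[OF smooth_atlas] tangent_space_scale[OF smooth_atlas])
  qed
  have l: "g p (lincomb3 x y z e1 e2 e3 p) w
      = x * g p (e1 p) w + y * g p (e2 p) w + z * g p (e3 p) w"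
    if "w \<in> tangent_space A p" for x y z w
    using that unfolding lincomb3_def by (simp add: metric_lincomb3)
  have r: "g p w (lincomb3 x y z e1 e2 e3 p) = g p (lincomb3 x y z e1 e2 e3 p) w"
    if "w \<in> tangent_space A p" for x y z w
    using that t by (rule metric_sym)
  show ?thesis
    unfolding metric_tensor_def l[OF t] r[OF frame_tangent(1)] r[OF frame_tangent(2)]
      r[OF frame_tangent(3)] l[OF frame_tangent(1)] l[OF frame_tangent(2)] l[OF frame_tangent(3)]
    by simp
qed

end

section \<open>The Lie algebra of the group\<close>

locale g5_frame = lorentz_frame A g e1 e2 e3 + torsion_free_connection A D
  for A :: "('a::{t2_space, second_countable_topology}, real^3) atlas"
    and g :: "'a metric_field" and e1 e2 e3 :: "'a vfield" and D :: "'a connection" +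
  fixes \<alpha> \<beta> \<gamma> \<delta> :: real
  assumes metric_compatible: "\<And>X Y Z p. vector_field A X \<Longrightarrow> vector_field A Y \<Longrightarrow> vector_field A Z \<Longrightarrow>
      vf_app X (metric_tensor g Y Z) p
        = metric_tensor g (D X Y) Z p + metric_tensor g Y (D X Z) p"
    and bracket_12: "lie_bracket A e1 e2 = lincomb3 0 0 0 e1 e2 e3"
    and bracket_13: "lie_bracket A e1 e3 = lincomb3 \<alpha> \<beta> 0 e1 e2 e3"
    and bracket_23: "lie_bracket A e2 e3 = lincomb3 \<gamma> \<delta> 0 e1 e2 e3"
begin

section \<open>Fields with constant coefficients in the frame\<close>

abbreviation L :: "real \<Rightarrow> real \<Rightarrow> real \<Rightarrow> 'a vfield" where
  "L a b c \<equiv> lincomb3 a b c e1 e2 e3"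

lemma frame_eq: "e1 = L 1 0 0" "e2 = L 0 1 0" "e3 = L 0 0 1"
  by (simp_all add: lincomb3_def)

lemma lincomb3_L:
  "lincomb3 x y z (L a b c) (L a' b' c') (L a'' b'' c'')
    = L (x * a + y * a' + z * a'') (x * b + y * b' + z * b'') (x * c + y * c' + z * c'')"
  by (simp add: lincomb3_def fun_eq_iff algebra_simps)

lemma vf_diff_L: "vf_diff (L a b c) (L a' b' c') = L (a - a') (b - b') (c - c')"
  by (simp add: lincomb3_def vf_ops fun_eq_iff algebra_simps)

lemma vf_mult_const_L: "vf_mult (\<lambda>_. x) (L a b c) = L (x * a) (x * b) (x * c)"
  by (simp add: lincomb3_def vf_ops fun_eq_iff algebra_simps)

lemma L_cong: "a = a' \<Longrightarrow> b = b' \<Longrightarrow> c = c' \<Longrightarrow> L a b c = L a' b' c'"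
  by simp

section \<open>Brackets and the connection on the frame\<close>

lemma bracket_self: "lie_bracket A X X = L 0 0 0"
  by (simp add: lie_bracket_def lincomb3_def fun_eq_iff)

lemma bracket_frame:
  "lie_bracket A e1 e1 = L 0 0 0" "lie_bracket A e2 e2 = L 0 0 0" "lie_bracket A e3 e3 = L 0 0 0"
  "lie_bracket A e1 e2 = L 0 0 0" "lie_bracket A e2 e1 = L 0 0 0"
  "lie_bracket A e1 e3 = L \<alpha> \<beta> 0" "lie_bracket A e3 e1 = L (-\<alpha>) (-\<beta>) 0"
  "lie_bracket A e2 e3 = L \<gamma> \<delta> 0" "lie_bracket A e3 e2 = L (-\<gamma>) (-\<delta>) 0"
  using bracket_12 bracket_13 bracket_23
    bracket_swap[of e1 e2] bracket_swap[of e1 e3] bracket_swap[of e2 e3]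
  by (simp_all add: vf_mult_const_L bracket_self)

text \<open>Derivatives of the inner products drop out because these are constant. Three cyclic
  instances of metric compatibility (\<open>comp\<close>), combined with torsion-freeness
  (\<open>tor\<close>), leave only brackets.\<close>

lemma koszul:
  assumes vf: "vector_field A X" "vector_field A Y" "vector_field A Z"
    and const: "metric_tensor g X Y = (\<lambda>_. k)" "metric_tensor g Y Z = (\<lambda>_. l)"
      "metric_tensor g Z X = (\<lambda>_. m)"
  shows "2 * metric_tensor g (D X Y) Z p = metric_tensor g (lie_bracket A X Y) Z p
    - metric_tensor g (lie_bracket A Y Z) X p + metric_tensor g (lie_bracket A Z X) Y p"
proof -
  have sym: "metric_tensor g U V p = metric_tensor g V U p"
    if "vector_field A U" "vector_field A V" for U V
    using that unfolding metric_tensor_def by (intro metric_sym vector_field_tangent)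
  have tor: "metric_tensor g (lie_bracket A U V) W p
      = metric_tensor g (D U V) W p - metric_tensor g (D V U) W p"
    if UVW: "vector_field A U" "vector_field A V" "vector_field A W" for U V W
  proof -
    have "lie_bracket A U V p = tv_add (tv_scale 1 (D U V p)) (tv_scale (-1) (D V U p))"
      using torsion_free[OF UVW(1,2), symmetric] by (simp add: vf_ops)
    then show ?thesis
      using UVW metric_lincomb2[of "D U V p" p "D V U p" "W p" 1 "-1"]
      by (simp add: metric_tensor_def vector_field_tangent)
  qed
  have comp: "metric_tensor g (D U V) W p + metric_tensor g (D U W) V p = 0"
    if "vector_field A U" "vector_field A V" "vector_field A W" "metric_tensor g V W = (\<lambda>_. n)"
    for U V W n
    using that metric_compatible[of U V W p] sym[of V "D U W"]
    by (simp add: vector_field_app_const)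
  show ?thesis
    using comp[OF vf const(2)] comp[OF vf(2,3,1) const(3)] comp[OF vf(3,1,2) const(1)]
    by (simp add: tor vf)
qed

text \<open>A field is determined by its inner products with the frame; the minus sign at
  \<open>c\<close> comes from the norm of \<open>e3\<close>.\<close>

lemma eq_L_I:
  assumes "vector_field A X" "\<And>p. metric_tensor g X e1 p = a"
    "\<And>p. metric_tensor g X e2 p = b" "\<And>p. metric_tensor g X e3 p = - c"
  shows "X = L a b c"
proof
  fix p
  show "X p = L a b c p"
    by (subst tangent_expansion[OF vector_field_tangent[OF assms(1)]])
      (use assms(2-4)[of p] in \<open>simp add: metric_tensor_def lincomb3_def\<close>)
qed

lemma metric_tensor_frame:
  "metric_tensor g e1 e1 = (\<lambda>_. 1)" "metric_tensor g e2 e2 = (\<lambda>_. 1)"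
  "metric_tensor g e3 e3 = (\<lambda>_. -1)"
  "metric_tensor g e1 e2 = (\<lambda>_. 0)" "metric_tensor g e2 e1 = (\<lambda>_. 0)"
  "metric_tensor g e1 e3 = (\<lambda>_. 0)" "metric_tensor g e3 e1 = (\<lambda>_. 0)"
  "metric_tensor g e2 e3 = (\<lambda>_. 0)" "metric_tensor g e3 e2 = (\<lambda>_. 0)"
  by (simp_all add: metric_tensor_def)

text \<open>Brings all pairs of frame fields into the constant-function form that
  \<open>koszul\<close> expects; \<open>undefined\<close> is just some point at which the constant
  is read off.\<close>

lemma metric_tensor_frame_const:
  assumes "X \<in> {e1, e2, e3}" "Y \<in> {e1, e2, e3}"
  shows "metric_tensor g X Y = (\<lambda>_. metric_tensor g X Y undefined)"
  using assms by (elim insertE emptyE) (simp_all only: metric_tensor_frame)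

lemma metric_tensor_L_frame:
  "metric_tensor g (L a b c) e1 p = a" "metric_tensor g (L a b c) e2 p = b"
  "metric_tensor g (L a b c) e3 p = - c"
  using metric_frame_lincomb[of a b c 1 0 0 p] metric_frame_lincomb[of a b c 0 1 0 p]
    metric_frame_lincomb[of a b c 0 0 1 p]
  by (simp_all flip: frame_eq)

text \<open>Bracketing with \<open>e3\<close> acts on the span of \<open>e1\<close> and
  \<open>e2\<close> by a matrix. Its symmetric part, with off-diagonal entry
  \<open>(\<beta> + \<gamma>) / 2\<close>, governs the derivatives along \<open>e1\<close> and
  \<open>e2\<close>; its skew part is the rotation seen in the derivatives along
  \<open>e3\<close>.\<close>

lemma D_frame:
  "D e1 e1 = L 0 0 \<alpha>" "D e1 e2 = L 0 0 ((\<beta> + \<gamma>) / 2)" "D e1 e3 = L \<alpha> ((\<beta> + \<gamma>) / 2) 0"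
  "D e2 e1 = L 0 0 ((\<beta> + \<gamma>) / 2)" "D e2 e2 = L 0 0 \<delta>" "D e2 e3 = L ((\<beta> + \<gamma>) / 2) \<delta> 0"
  "D e3 e1 = L 0 ((\<gamma> - \<beta>) / 2) 0" "D e3 e2 = L ((\<beta> - \<gamma>) / 2) 0 0" "D e3 e3 = L 0 0 0"
proof -
  have *: "metric_tensor g (D X Y) Z p = (metric_tensor g (lie_bracket A X Y) Z p
    - metric_tensor g (lie_bracket A Y Z) X p + metric_tensor g (lie_bracket A Z X) Y p) / 2"
    if "X \<in> {e1, e2, e3}" "Y \<in> {e1, e2, e3}" "Z \<in> {e1, e2, e3}" for X Y Z p
  proof -
    have "vector_field A X" "vector_field A Y" "vector_field A Z" using that by auto
    from koszul[OF this metric_tensor_frame_const[OF that(1,2)]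
        metric_tensor_frame_const[OF that(2,3)] metric_tensor_frame_const[OF that(3,1)], of p]
    show ?thesis by simp
  qed
  show "D e1 e1 = L 0 0 \<alpha>" "D e1 e2 = L 0 0 ((\<beta> + \<gamma>) / 2)" "D e1 e3 = L \<alpha> ((\<beta> + \<gamma>) / 2) 0"
    "D e2 e1 = L 0 0 ((\<beta> + \<gamma>) / 2)" "D e2 e2 = L 0 0 \<delta>" "D e2 e3 = L ((\<beta> + \<gamma>) / 2) \<delta> 0"
    "D e3 e1 = L 0 ((\<gamma> - \<beta>) / 2) 0" "D e3 e2 = L ((\<beta> - \<gamma>) / 2) 0 0" "D e3 e3 = L 0 0 0"
    by (rule eq_L_I; simp add: * bracket_frame metric_tensor_L_frame add_divide_distrib diff_divide_distrib)+
qed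

lemma D_L:
  "D (L a b c) (L a' b' c') = L
    (a * c' * \<alpha> + b * c' * ((\<beta> + \<gamma>) / 2) + c * b' * ((\<beta> - \<gamma>) / 2))
    (a * c' * ((\<beta> + \<gamma>) / 2) + b * c' * \<delta> + c * a' * ((\<gamma> - \<beta>) / 2))
    (a * a' * \<alpha> + (a * b' + b * a') * ((\<beta> + \<gamma>) / 2) + b * b' * \<delta>)"
  by (simp add: D_lincomb3_left D_lincomb3_right D_frame lincomb3_L)
    (rule L_cong; simp add: field_simps)

lemma bracket_L:
  "lie_bracket A (L a b c) (L a' b' c')
    = L ((a * c' - c * a') * \<alpha> + (b * c' - c * b') * \<gamma>)
        ((a * c' - c * a') * \<beta> + (b * c' - c * b') * \<delta>) 0"
  by (simp add: D_L vf_diff_L flip: torsion_free) (rule L_cong; simp add: field_simps)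

lemmas curvature_L = curvature_def D_L bracket_L vf_diff_L

text \<open>Inner products of constant-coefficient fields are constant, so the term differentiated
  along the soliton field vanishes.\<close>

lemma lie_derivative_L:
  "lie_derivative_metric A g (L x y z) (L a b c) (L a' b' c') p
    = - metric_tensor g (lie_bracket A (L x y z) (L a b c)) (L a' b' c') p
      - metric_tensor g (L a b c) (lie_bracket A (L x y z) (L a' b' c')) p"
proof -
  have "metric_tensor g (L a b c) (L a' b' c') = (\<lambda>_. a * a' + b * b' - c * c')"
    using metric_frame_lincomb by blast
  then show ?thesis
    by (simp add: lie_derivative_metric_def vector_field_app_const[OF vf_lincomb3[OF vf_frame]])
qed

section \<open>Necessary conditions from the frame\<close>

lemma soliton_L:
  assumes "left_invariant_riemann_soliton A mul g D (L x y z) lam"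
  shows "- metric_tensor g (curvature A D (L a1 b1 c1) (L a2 b2 c2) (L a3 b3 c3)) (L a4 b4 c4) p
    + 1/2 * kulkarni_nomizu (lie_derivative_metric A g (L x y z)) (metric_tensor g)
        (L a1 b1 c1) (L a2 b2 c2) (L a3 b3 c3) (L a4 b4 c4) p
    = lam / 2 * kulkarni_nomizu (metric_tensor g) (metric_tensor g)
        (L a1 b1 c1) (L a2 b2 c2) (L a3 b3 c3) (L a4 b4 c4) p"
  using assms unfolding left_invariant_riemann_soliton_def curvature_tensor_def by simp

text \<open>The first three equations come from quadruples of frame fields with indices of type (i,
  j, j, i), the others from off-diagonal ones (i, j, j, k).\<close>

lemma soliton_equations:
  assumes "left_invariant_riemann_soliton A mul g D (L x y z) lam"
    and orth: "\<alpha> * \<gamma> + \<beta> * \<delta> = 0"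
  shows "z * (\<alpha> + \<delta>) - (\<alpha> * \<delta> - ((\<beta> + \<gamma>) / 2)\<^sup>2) = lam"
    and "z * \<alpha> - (\<alpha>\<^sup>2 + (\<beta> + \<gamma>) / 2 * ((\<beta> + \<gamma>) / 2 + \<beta> - \<gamma>)) = lam"
    and "z * \<delta> - (\<delta>\<^sup>2 + (\<beta> + \<gamma>) / 2 * ((\<beta> + \<gamma>) / 2 + \<gamma> - \<beta>)) = lam"
    and "z * (\<beta> + \<gamma>) = 0"
    and "x * \<alpha> + y * \<gamma> = 0" and "x * \<beta> + y * \<delta> = 0"
proof -
  note simps = kulkarni_nomizu_def lie_derivative_L curvature_L metric_frame_lincomb
  note sol = soliton_L[OF assms(1)]
  show "z * (\<alpha> + \<delta>) - (\<alpha> * \<delta> - ((\<beta> + \<gamma>) / 2)\<^sup>2) = lam"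
    using sol[of 1 0 0 0 1 0 0 1 0 1 0 0 undefined]
    by (simp add: simps power2_eq_square field_simps)
  show "z * \<alpha> - (\<alpha>\<^sup>2 + (\<beta> + \<gamma>) / 2 * ((\<beta> + \<gamma>) / 2 + \<beta> - \<gamma>)) = lam"
    using sol[of 1 0 0 0 0 1 0 0 1 1 0 0 undefined]
    by (simp add: simps power2_eq_square field_simps)
  show "z * \<delta> - (\<delta>\<^sup>2 + (\<beta> + \<gamma>) / 2 * ((\<beta> + \<gamma>) / 2 + \<gamma> - \<beta>)) = lam"
    using sol[of 0 1 0 0 0 1 0 0 1 0 1 0 undefined]
    by (simp add: simps power2_eq_square field_simps)
  \<comment> \<open>For indices (1, 3, 3, 2) the curvature component is a multiple of
    \<open>\<alpha> * \<gamma> + \<beta> * \<delta>\<close>, so \<open>orth\<close> removes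
    it.\<close>
  show "z * (\<beta> + \<gamma>) = 0"
    using sol[of 1 0 0 0 0 1 0 0 1 0 1 0 undefined] orth
    by (simp add: simps field_simps)
  \<comment> \<open>In this quadruple and the next the curvature component is zero, which isolates
    the Lie derivative.\<close>
  show "x * \<alpha> + y * \<gamma> = 0"
    using sol[of 1 0 0 0 1 0 0 1 0 0 0 1 undefined]
    by (simp add: simps field_simps)
  show "x * \<beta> + y * \<delta> = 0"
    using sol[of 0 1 0 1 0 0 1 0 0 0 0 1 undefined]
    by (simp add: simps field_simps)
qed


section \<open>Constant curvature\<close>

definition has_constant_curvature :: "'a vfield \<Rightarrow> 'a vfield \<Rightarrow> 'a vfield \<Rightarrow> bool" where
  "has_constant_curvature X Y Z \<longleftrightarrow> curvature A D X Y Z = vf_mult (\<lambda>_. \<alpha>\<^sup>2)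
    (vf_diff (vf_mult (metric_tensor g Y Z) X) (vf_mult (metric_tensor g X Z) Y))"

text \<open>Under these conditions the symmetric part of the bracket matrix is \<alpha> times the
  identity, and the contributions of \<beta> cancel in the curvature.\<close>

lemma constant_curvature_L:
  assumes "\<alpha> = \<delta>" "\<beta> + \<gamma> = 0"
  shows "has_constant_curvature (L a b c) (L a' b' c') (L a'' b'' c'')"
proof -
  have [simp]: "\<delta> = \<alpha>" "\<gamma> = - \<beta>" using assms by auto
  have "metric_tensor g (L a b c) (L a' b' c') = (\<lambda>_. a * a' + b * b' - c * c')"
    for a b c a' b' c'
    using metric_frame_lincomb by blast
  then show ?thesis
    unfolding has_constant_curvature_def curvature_L vf_mult_const_L
    by (simp add: vf_mult_const_L vf_diff_L)
      (rule L_cong; simp add: power2_eq_square algebra_simps)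
qed

text \<open>Both sides of the identity are linear over the smooth functions in the first slot, so
  \<open>frame_induct\<close> applies.\<close>

lemma constant_curvature_1:
  assumes "vector_field A X" "vector_field A Y" "vector_field A Z"
    and "has_constant_curvature e1 Y Z" "has_constant_curvature e2 Y Z"
      "has_constant_curvature e3 Y Z"
  shows "has_constant_curvature X Y Z"
  using assms(1)
proof (induction rule: frame_induct)
  case (add U V)
  then show ?case
    using assms(2,3)
    by (simp add: has_constant_curvature_def curvature_add_1 metric_tensor_add_left)
      (simp add: vf_ops fun_eq_iff algebra_simps)
next
  case (mult h U)
  then show ?case
    using assms(2,3)
    by (simp add: has_constant_curvature_def curvature_mult_1 metric_tensor_mult_left)
      (simp add: vf_ops fun_eq_iff algebra_simps)
qed (use assms in simp_all)

lemma constant_curvature_3: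
  assumes "vector_field A X" "vector_field A Y" "vector_field A Z"
    and "has_constant_curvature X Y e1" "has_constant_curvature X Y e2"
      "has_constant_curvature X Y e3"
  shows "has_constant_curvature X Y Z"
  using assms(3)
proof (induction rule: frame_induct)
  case (add U V)
  then show ?case
    using assms(1,2)
    by (simp add: has_constant_curvature_def curvature_add_3 metric_tensor_add_right)
      (simp add: vf_ops fun_eq_iff algebra_simps)
next
  case (mult h U)
  then show ?case
    using assms(1,2)
    by (simp add: has_constant_curvature_def curvature_mult_3 metric_tensor_mult_right)
      (simp add: vf_ops fun_eq_iff algebra_simps)
qed (use assms in simp_all)

lemma constant_curvature_swap:
  assumes "vector_field A X" "vector_field A Y" "vector_field A Z"
    and "has_constant_curvature X Y Z"
  shows "has_constant_curvature Y X Z"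
  using assms
  by (simp add: has_constant_curvature_def curvature_swap[of X Y Z])
    (simp add: vf_ops fun_eq_iff algebra_simps)

text \<open>The slots are freed one after another, starting from constant-coefficient fields: first
  the third, then the second through antisymmetry, then the first.\<close>

lemma constant_curvature:
  assumes "\<alpha> = \<delta>" "\<beta> + \<gamma> = 0"
    and vf: "vector_field A X" "vector_field A Y" "vector_field A Z"
  shows "has_constant_curvature X Y Z"
proof -
  note LLL = constant_curvature_L[OF assms(1,2)]
  have 1: "has_constant_curvature (L a b c) (L a' b' c') Z" for a b c a' b' c'
    by (rule constant_curvature_3)
      (use vf(3) LLL[of a b c a' b' c' 1 0 0] LLL[of a b c a' b' c' 0 1 0]
      LLL[of a b c a' b' c' 0 0 1] in \<open>simp_all flip: frame_eq\<close>)
  have 2: "has_constant_curvature (L a b c) Y Z" for a b c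
    \<comment> \<open>Swapping moves \<open>Y\<close> to the first slot, where it is expanded in the
      frame.\<close>
    by (rule constant_curvature_swap[of Y, OF _ _ _ constant_curvature_1])
      (use vf 1[of 1 0 0 a b c] 1[of 0 1 0 a b c] 1[of 0 0 1 a b c] in \<open>simp_all flip: frame_eq\<close>)
  show ?thesis
    by (rule constant_curvature_1)
      (use vf 2[of 1 0 0] 2[of 0 1 0] 2[of 0 0 1] in \<open>simp_all flip: frame_eq\<close>)
qed

text \<open>The minus sign stems from the convention in \<open>curvature_tensor\<close>; it is why
  the soliton constant is \<open>- \<alpha>\<^sup>2\<close>.\<close>

lemma constant_curvature_tensor:
  assumes "\<alpha> = \<delta>" "\<beta> + \<gamma> = 0"
    and vf: "vector_field A X" "vector_field A Y" "vector_field A Z" "vector_field A W"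
  shows "curvature_tensor A g D X Y Z W p = - \<alpha>\<^sup>2 *
    (metric_tensor g Y Z p * metric_tensor g X W p - metric_tensor g X Z p * metric_tensor g Y W p)"
  using constant_curvature[OF assms(1-5)] smooth_metric vf
  by (simp add: has_constant_curvature_def curvature_tensor_def vf_diff_eq
      metric_tensor_add_left metric_tensor_mult_left)

section \<open>The zero field and the final equivalence\<close>

lemma lie_derivative_zero:
  assumes "vector_field A Y" "vector_field A Z"
  shows "lie_derivative_metric A g (L 0 0 0) Y Z p = 0"
proof -
  \<comment> \<open>As \<open>U\<close> is arbitrary, the bracket is evaluated on functions: one
    term is the zero derivation, the other is \<open>U\<close> applied to the constant 0.\<close>
  have "lie_bracket A (L 0 0 0) U = L 0 0 0" if "vector_field A U" for U
    using that vector_field_app_const[OF that, of 0]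
    by (simp add: lie_bracket_def lincomb3_def vf_app_def fun_eq_iff)
  moreover have "g p (L 0 0 0 p) (U p) = 0" "g p (U p) (L 0 0 0 p) = 0" if "vector_field A U" for U
    using that metric_lincomb3[of "e1 p" p "e2 p" "e3 p" "U p" 0 0 0]
      metric_sym[of "U p" p "L 0 0 0 p"] vector_field_tangent[OF vf_lincomb3[OF vf_frame], of 0 0 0 p]
    by (simp_all add: vector_field_tangent lincomb3_def)
  ultimately show ?thesis
    using assms by (simp add: lie_derivative_metric_def metric_tensor_def)
      (simp add: vf_app_def lincomb3_def)
qed

lemma zero_in_lie_algebra: "L 0 0 0 \<in> lie_algebra A mul"
  using vf_lincomb3[OF vf_frame, of 0 0 0]
  by (simp add: lie_algebra_def) (simp add: lincomb3_def push_left_def)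

lemma soliton_iff:
  assumes nz: "\<alpha> + \<delta> \<noteq> 0" and orth: "\<alpha> * \<gamma> + \<beta> * \<delta> = 0"
  shows "left_invariant_riemann_soliton A mul g D (L x y z) lam \<longleftrightarrow>
    \<alpha> = \<delta> \<and> \<beta> + \<gamma> = 0 \<and> x = 0 \<and> y = 0 \<and> z = 0 \<and> lam = - \<alpha>\<^sup>2"
proof
  assume "left_invariant_riemann_soliton A mul g D (L x y z) lam"
  note eqs = soliton_equations[OF this orth]
  have z: "z = 0"
  proof (rule ccontr)
    assume "z \<noteq> 0"
    then have \<gamma>: "\<gamma> = - \<beta>" using eqs(4) by simp
    \<comment> \<open>With \<open>\<gamma> = - \<beta>\<close>, subtracting the second and the third
      equation from the first leaves these. Their sum gives \<open>s\<close>, their difference the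
      factorisation below.\<close>
    have d: "z * \<delta> = \<alpha> * \<delta> - \<alpha>\<^sup>2" "z * \<alpha> = \<alpha> * \<delta> - \<delta>\<^sup>2"
      using eqs(1-3) unfolding \<gamma> by (simp_all add: algebra_simps)
    have s: "z * (\<alpha> + \<delta>) = - (\<alpha> - \<delta>)\<^sup>2"
      using d by (simp add: power2_eq_square algebra_simps)
    from d have "(z - (\<alpha> + \<delta>)) * (\<alpha> - \<delta>) = 0"
      by (simp add: power2_eq_square algebra_simps)
    moreover have "z \<noteq> \<alpha> + \<delta>"
    proof
      assume "z = \<alpha> + \<delta>"
      with s have "(\<alpha> + \<delta>)\<^sup>2 + (\<alpha> - \<delta>)\<^sup>2 = 0"
        by (simp add: power2_eq_square)
      with nz show False by simp
    qed
    ultimately have "\<alpha> = \<delta>" by simp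
    with s nz \<open>z \<noteq> 0\<close> show False by simp
  qed
  \<comment> \<open>With \<open>z = 0\<close>, twice the first equation minus the second and the
    third gives a vanishing sum of squares.\<close>
  have "(\<alpha> - \<delta>)\<^sup>2 + (\<beta> + \<gamma>)\<^sup>2 = 0"
    using eqs(1-3) z by (simp add: power2_eq_square field_simps)
  then have *: "\<alpha> = \<delta>" "\<gamma> = - \<beta>"
    by (simp_all)
  have "\<alpha> \<noteq> 0" using nz * by simp
  \<comment> \<open>The system in \<open>x\<close> and \<open>y\<close> now has the matrix of a
    scaled rotation; multiplying by its transpose yields the determinant times the unknowns.\<close>
  have "(\<alpha>\<^sup>2 + \<beta>\<^sup>2) * x = \<alpha> * (x * \<alpha> + y * \<gamma>) + \<beta> * (x * \<beta> + y * \<delta>)"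
    "(\<alpha>\<^sup>2 + \<beta>\<^sup>2) * y = \<alpha> * (x * \<beta> + y * \<delta>) - \<beta> * (x * \<alpha> + y * \<gamma>)"
    by (simp_all add: * power2_eq_square algebra_simps)
  then have "(\<alpha>\<^sup>2 + \<beta>\<^sup>2) * x = 0" "(\<alpha>\<^sup>2 + \<beta>\<^sup>2) * y = 0"
    unfolding eqs(5,6) by simp_all
  moreover have "\<alpha>\<^sup>2 + \<beta>\<^sup>2 \<noteq> 0"
    using \<open>\<alpha> \<noteq> 0\<close> by simp
  ultimately have "x = 0" "y = 0" by auto
  with z * eqs(2) show "\<alpha> = \<delta> \<and> \<beta> + \<gamma> = 0 \<and> x = 0 \<and> y = 0 \<and> z = 0 \<and> lam = - \<alpha>\<^sup>2"
    by simp
next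
  assume *: "\<alpha> = \<delta> \<and> \<beta> + \<gamma> = 0 \<and> x = 0 \<and> y = 0 \<and> z = 0 \<and> lam = - \<alpha>\<^sup>2"
  then show "left_invariant_riemann_soliton A mul g D (L x y z) lam"
    using zero_in_lie_algebra[of mul]
    unfolding left_invariant_riemann_soliton_def kulkarni_nomizu_def
    by (simp add: constant_curvature_tensor lie_derivative_zero algebra_simps)
qed

end

theorem theorem2p5:
  fixes A :: "('a::{t2_space, second_countable_topology}, real^3) atlas"
    and mul :: "'a \<Rightarrow> 'a \<Rightarrow> 'a" and u :: 'a and iv :: "'a \<Rightarrow> 'a"
    and g :: "'a metric_field" and D :: "'a connection"
    and e1 e2 e3 :: "'a vfield"
    and \<alpha> \<beta> \<gamma> \<delta> lam1 lam2 lam3 lam :: real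
  assumes "\<alpha> + \<delta> \<noteq> 0" and "\<alpha> * \<gamma> + \<beta> * \<delta> = 0"
    and "lie_group A mul u iv"
    and "connected (UNIV :: 'a set)" and "simply_connected (UNIV :: 'a set)"
    and "lorentzian_metric A g" and "left_invariant_metric A mul g"
    and "levi_civita A g D"
    and "lie_algebra_basis3 A mul e1 e2 e3"
    and "\<forall>p. pseudo_orthonormal3 (g p) (e1 p) (e2 p) (e3 p)"
    and "lie_bracket A e1 e2 = lincomb3 0 0 0 e1 e2 e3"
    and "lie_bracket A e1 e3 = lincomb3 \<alpha> \<beta> 0 e1 e2 e3"
    and "lie_bracket A e2 e3 = lincomb3 \<gamma> \<delta> 0 e1 e2 e3"
  shows "left_invariant_riemann_soliton A mul g D (lincomb3 lam1 lam2 lam3 e1 e2 e3) lam \<longleftrightarrow>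
    (\<beta> + \<gamma> = 0 \<and> \<beta> \<noteq> 0 \<and> \<alpha> = \<delta> \<and> \<alpha> \<noteq> 0 \<and>
       lam1 = 0 \<and> lam2 = 0 \<and> lam3 = 0 \<and> lam = - \<alpha>\<^sup>2) \<or>
    (\<beta> = 0 \<and> \<gamma> = 0 \<and> \<alpha> = \<delta> \<and> \<alpha> \<noteq> 0 \<and>
       lam1 = 0 \<and> lam2 = 0 \<and> lam3 = 0 \<and> lam = - \<alpha>\<^sup>2)"
proof -
  have vf: "vector_field A e1" "vector_field A e2" "vector_field A e3"
    using assms(9) unfolding lie_algebra_basis3_def lie_algebra_def by auto
  interpret g5_frame A g e1 e2 e3 D \<alpha> \<beta> \<gamma> \<delta>
    using assms(3,6,8,10-13) vf
    unfolding lie_group_def levi_civita_def by unfold_locales auto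
  show ?thesis
    \<comment> \<open>The two alternatives merely separate nonzero from zero \<beta>; \<alpha> is
      nonzero because \<open>\<alpha> = \<delta>\<close> and
      \<open>\<alpha> + \<delta> \<noteq> 0\<close>.\<close>
    unfolding soliton_iff[OF assms(1,2)] using assms(1) by auto
qed

end
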